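(* Let $S^1=\mathbb{R}/\mathbb{Z}$ with its usual metric, let $r\in[0,1)$ be a random real and let $T:S^1\to S^1$ be $T(x)=x+r\ (\mathrm{mod}\ 1)$. Then $\hat{K}^{\log}(x,T)>0$ for every $x\in S^1$, and $h^f(T)=0$ for every monotonic function $f:\mathbb{N}\to\mathbb{R}$ with $\lim_{n\to\infty}f(n)=\infty$.
   Context: Algorithmic information content. Let $\Sigma=\{0,1\}^*$ be the set of finite (possibly empty) binary strings and $|p|$ the length of $p\in\Sigma$. Fix a universal computing machine (universal partial recursive function) $\mathcal{U}$ taking binary strings as programs and giving as output strings over a finite alphabet, and a recursive injective encoding $(s',p)\mapsto\langle s',p\rangle$ of pairs of strings into strings, from which $\mathcal{U}$ can recover both components; universal means that it can emulate any other computing machine when given an appropriate fixed additional input. The algorithmic information content of $s$ is $AIC(s)=\min\{|p| : \mathcal{U}(p)=s\}$, and the conditional one is $AIC(s|s')=\min\{|p| : \mathcal{U}(\langle s',p\rangle)=s\}$. A natural number $n$ used as a condition is represented by its binary expansion. Random real. A real $r\in[0,1)$ with binary expansion $r=0.r_1r_2\ldots$ is called random here if $\lim_{n\to\infty}\frac{AIC(r_1\ldots r_n)}{n}=1$. Orbit complexity. Let $X$ be a compact metric space and $T:X\to X$. For a finite open cover $\beta=\{B_0,\dots,B_{N-1}\}$ of $X$ and $x\in X$ let $$\varphi_\beta(x)=\{\omega\in\{0,\dots,N-1\}^{\mathbb{N}} : \forall n\in\mathbb{N},\ T^n(x)\in B_{\omega(n)}\}.$$ Let $\omega^n$ denote the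 string of the first $n$ digits of $\omega$, and put $\hat{K}(x,T,\beta,n)=\min_{\omega\in\varphi_\beta(x)}AIC(\omega^n|n)$, $\hat{K}^f(x,T,\beta)=\limsup_{n\to\infty}\hat{K}(x,T,\beta,n)/f(n)$ and $\hat{K}^f(x,T)=\sup_\beta\hat{K}^f(x,T,\beta)$, the supremum being over all finite open covers $\beta$ of $X$. $\hat{K}^{\log}$ is this quantity for $f(n)=\log n$. Generalized topological entropy. Points $x,y\in X$ are $(n,\epsilon)$-separated if $d(T^k(x),T^k(y))>\epsilon$ for some $k\in\{0,\dots,n-1\}$. A set $E\subset X$ is $(n,\epsilon)$-separated if any two distinct points of $E$ are $(n,\epsilon)$-separated. Let $s(n,\epsilon)$ be the maximal cardinality of an $(n,\epsilon)$-separated set, $h^f(T,\epsilon)=\limsup_{n\to\infty}\frac{\log s(n,\epsilon)}{f(n)}$ and $h^f(T)=\lim_{\epsilon\to0}h^f(T,\epsilon)$. *)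

theory Defs
  imports "HOL-Analysis.Analysis" "HOL-Library.Nat_Bijection" "HOL-Library.Extended_Nat"
    "HOL-Library.Extended_Real"
begin

text \<open>
  Kleene's partial recursive functions on tuples of natural numbers. Arities are not tracked in the
  syntax: a code denotes, for each \<open>k\<close>, a partial recursive function of \<open>k\<close> arguments.
\<close>

datatype recf =
    Zero
  | Succ
  | Proj nat
  | Comp recf "recf list"
  | PrimRec recf recf
  | Mu recf

inductive computes :: "recf \<Rightarrow> nat list \<Rightarrow> nat \<Rightarrow> bool" where
  zero: "computes Zero xs 0"
| succ: "computes Succ [x] (Suc x)"
| proj: "i < length xs \<Longrightarrow> computes (Proj i) xs (xs ! i)"
| comp: "\<lbrakk>list_all2 (\<lambda>g y. computes g xs y) gs ys; computes f ys z\<rbrakk> \<Longrightarrow> computes (Comp f gs) xs z"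
| primrec_0: "computes f xs y \<Longrightarrow> computes (PrimRec f g) (0 # xs) y"
| primrec_Suc: "\<lbrakk>computes (PrimRec f g) (n # xs) y; computes g (n # y # xs) z\<rbrakk>
    \<Longrightarrow> computes (PrimRec f g) (Suc n # xs) z"
| mu: "\<lbrakk>computes f (n # xs) 0; \<forall>m<n. \<exists>y. computes f (m # xs) (Suc y)\<rbrakk>
    \<Longrightarrow> computes (Mu f) xs n"

text \<open>
  Programs and conditions are binary strings. Outputs are of type \<^typ>\<open>nat list\<close>, so that
  strings over every finite alphabet \<open>{0, \<dots>, N - 1}\<close> are outputs of one and the same machine.
  Strings are numbered by the bijection \<^const>\<open>list_encode\<close>, which is built from Cantor's pairing
  function.
\<close>

definition code :: "bool list \<Rightarrow> nat" where
  "code p = list_encode (map of_bool p)"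

definition machine :: "(bool list \<Rightarrow> nat list option) \<Rightarrow> bool" where
  "machine V \<longleftrightarrow> (\<exists>c. \<forall>p s. V p = Some s \<longleftrightarrow> computes c [code p] (list_encode s))"

definition cond_machine :: "(bool list \<Rightarrow> bool list \<Rightarrow> nat list option) \<Rightarrow> bool" where
  "cond_machine V \<longleftrightarrow>
     (\<exists>c. \<forall>s' p s. V s' p = Some s \<longleftrightarrow> computes c [code s', code p] (list_encode s))"

definition recursive_pairing :: "(bool list \<Rightarrow> bool list \<Rightarrow> bool list) \<Rightarrow> bool" where
  "recursive_pairing pr \<longleftrightarrow>
     inj (\<lambda>(s', p). pr s' p) \<and> (\<exists>c. \<forall>s' p. computes c [code s', code p] (code (pr s' p)))"

text \<open>
  The additional input \<open>w\<close> that makes \<open>U\<close> emulate another machine is prefixed to the program. The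
  last clause says that \<open>U\<close> recovers both components of a pair: run on \<open>pr s' p\<close>, it emulates every
  machine that has access to a condition \<open>s'\<close> besides its program.
\<close>

definition universal_machine ::
    "(bool list \<Rightarrow> nat list option) \<Rightarrow> (bool list \<Rightarrow> bool list \<Rightarrow> bool list) \<Rightarrow> bool" where
  "universal_machine U pr \<longleftrightarrow>
     machine U \<and>
     (\<forall>V. machine V \<longrightarrow> (\<exists>w. \<forall>p. U (w @ p) = V p)) \<and>
     (\<forall>V. cond_machine V \<longrightarrow> (\<exists>w. \<forall>s' p. U (pr s' (w @ p)) = V s' p))"

definition AIC :: "(bool list \<Rightarrow> nat list option) \<Rightarrow> nat list \<Rightarrow> enat" where
  "AIC U s = (INF p \<in> {p. U p = Some s}. enat (length p))"

definition AIC_cond ::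
    "(bool list \<Rightarrow> nat list option) \<Rightarrow> (bool list \<Rightarrow> bool list \<Rightarrow> bool list) \<Rightarrow>
     nat list \<Rightarrow> bool list \<Rightarrow> enat" where
  "AIC_cond U pr s s' = (INF p \<in> {p. U (pr s' p) = Some s}. enat (length p))"

text \<open>Most significant digit first.\<close>

fun binary_expansion :: "nat \<Rightarrow> bool list" where
  "binary_expansion n = (if n < 2 then [n = 1] else binary_expansion (n div 2) @ [odd n])"

declare binary_expansion.simps [simp del]

definition binary_digit :: "real \<Rightarrow> nat \<Rightarrow> nat" where
  "binary_digit r i = nat (\<lfloor>2 ^ i * r\<rfloor> mod 2)"

definition random_real :: "(bool list \<Rightarrow> nat list option) \<Rightarrow> real \<Rightarrow> bool" where
  "random_real U r \<longleftrightarrow>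
     0 \<le> r \<and> r < 1 \<and>
     (\<lambda>n. ereal_of_enat (AIC U (map (binary_digit r) [1..<n+1])) / ereal (real n)) \<longlonglongrightarrow> 1"

text \<open>
  The space \<open>X\<close> is a type of class \<open>metric_space\<close>. A finite open cover \<open>{B\<^sub>0, \<dots>, B\<^sub>N\<^sub>-\<^sub>1}\<close> is given
  as a list, which fixes the numbering of its members.
\<close>

definition finite_open_cover :: "'a::metric_space set list \<Rightarrow> bool" where
  "finite_open_cover \<beta> \<longleftrightarrow> distinct \<beta> \<and> (\<forall>B\<in>set \<beta>. open B) \<and> \<Union>(set \<beta>) = UNIV"

definition symbolic_orbits :: "('a \<Rightarrow> 'a) \<Rightarrow> 'a set list \<Rightarrow> 'a \<Rightarrow> (nat \<Rightarrow> nat) set" where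
  "symbolic_orbits T \<beta> x = {\<omega>. \<forall>n. \<omega> n < length \<beta> \<and> (T ^^ n) x \<in> \<beta> ! \<omega> n}"

context
  fixes U :: "bool list \<Rightarrow> nat list option"
    and pr :: "bool list \<Rightarrow> bool list \<Rightarrow> bool list"
begin

definition K_hat :: "'a::metric_space \<Rightarrow> ('a \<Rightarrow> 'a) \<Rightarrow> 'a set list \<Rightarrow> nat \<Rightarrow> enat" where
  "K_hat x T \<beta> n =
     (INF \<omega> \<in> symbolic_orbits T \<beta> x. AIC_cond U pr (map \<omega> [0..<n]) (binary_expansion n))"

definition K_hat_cover ::
    "(nat \<Rightarrow> real) \<Rightarrow> 'a::metric_space \<Rightarrow> ('a \<Rightarrow> 'a) \<Rightarrow> 'a set list \<Rightarrow> ereal" where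
  "K_hat_cover f x T \<beta> = limsup (\<lambda>n. ereal_of_enat (K_hat x T \<beta> n) / ereal (f n))"

definition orbit_complexity ::
    "(nat \<Rightarrow> real) \<Rightarrow> 'a::metric_space \<Rightarrow> ('a \<Rightarrow> 'a) \<Rightarrow> ereal" where
  "orbit_complexity f x T = (SUP \<beta> \<in> {\<beta>. finite_open_cover \<beta>}. K_hat_cover f x T \<beta>)"

end

definition separated_points ::
    "('a::metric_space \<Rightarrow> 'a) \<Rightarrow> nat \<Rightarrow> real \<Rightarrow> 'a \<Rightarrow> 'a \<Rightarrow> bool" where
  "separated_points T n \<epsilon> x y \<longleftrightarrow> (\<exists>k<n. dist ((T ^^ k) x) ((T ^^ k) y) > \<epsilon>)"

definition separated_set :: "('a::metric_space \<Rightarrow> 'a) \<Rightarrow> nat \<Rightarrow> real \<Rightarrow> 'a set \<Rightarrow> bool" where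
  "separated_set T n \<epsilon> E \<longleftrightarrow> (\<forall>x\<in>E. \<forall>y\<in>E. x \<noteq> y \<longrightarrow> separated_points T n \<epsilon> x y)"

text \<open>
  Subsets of separated sets are separated, so restricting to finite ones gives \<open>\<infinity>\<close> exactly when
  there is no bound on the cardinality.
\<close>

definition max_separated :: "('a::metric_space \<Rightarrow> 'a) \<Rightarrow> nat \<Rightarrow> real \<Rightarrow> enat" where
  "max_separated T n \<epsilon> = (SUP E \<in> {E. finite E \<and> separated_set T n \<epsilon> E}. enat (card E))"

fun log_enat :: "enat \<Rightarrow> ereal" where
  "log_enat (enat n) = ereal (ln (real n))"
| "log_enat \<infinity> = \<infinity>"

definition entropy_at :: "(nat \<Rightarrow> real) \<Rightarrow> ('a::metric_space \<Rightarrow> 'a) \<Rightarrow> real \<Rightarrow> ereal" where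
  "entropy_at f T \<epsilon> = limsup (\<lambda>n. log_enat (max_separated T n \<epsilon>) / ereal (f n))"

definition gen_entropy :: "(nat \<Rightarrow> real) \<Rightarrow> ('a::metric_space \<Rightarrow> 'a) \<Rightarrow> ereal" where
  "gen_entropy f T = Lim (at_right 0) (entropy_at f T)"

quotient_type circle = real / "\<lambda>x y :: real. x - y \<in> \<int>"
proof (rule equivpI)
  show "reflp (\<lambda>x y :: real. x - y \<in> \<int>)"
    by (rule reflpI) simp
  show "symp (\<lambda>x y :: real. x - y \<in> \<int>)"
    by (rule sympI) (metis Ints_minus minus_diff_eq)
  show "transp (\<lambda>x y :: real. x - y \<in> \<int>)"
    by (rule transpI) (metis Ints_add add_diff_eq diff_add_cancel)
qed

text \<open>The metric is the quotient metric: the distance of \<open>x - y\<close> to the nearest integer.\<close>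

lemma nearest_int_shift:
  fixes z :: real
  shows "\<bar>z + of_int m - of_int (round (z + of_int m))\<bar> = \<bar>z - of_int (round z)\<bar>"
proof -
  have "round (z + of_int m) = round z + m"
    unfolding round_def by linarith
  then show ?thesis by simp
qed

instantiation circle :: metric_space
begin

lift_definition dist_circle :: "circle \<Rightarrow> circle \<Rightarrow> real"
  is "\<lambda>x y. \<bar>(x - y) - of_int (round (x - y))\<bar>"
proof -
  fix x x' y y' :: real
  assume "x - x' \<in> \<int>" "y - y' \<in> \<int>"
  then have "(x - x') - (y - y') \<in> \<int>" by (rule Ints_diff)
  then obtain m where "(x - x') - (y - y') = of_int m" by (elim Ints_cases)
  then have "x - y = x' - y' + of_int m" by linarith
  then show "\<bar>(x - y) - of_int (round (x - y))\<bar> = \<bar>(x' - y') - of_int (round (x' - y'))\<bar>"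
    by (simp only: nearest_int_shift)
qed

definition uniformity_circle :: "(circle \<times> circle) filter" where
  "uniformity_circle = (INF e\<in>{0<..}. principal {(x, y). dist x y < e})"

definition open_circle :: "circle set \<Rightarrow> bool" where
  "open_circle U \<longleftrightarrow> (\<forall>x\<in>U. eventually (\<lambda>(x', y). x' = x \<longrightarrow> y \<in> U) uniformity)"

instance
proof
  show "dist x y = 0 \<longleftrightarrow> x = y" for x y :: circle
  proof transfer
    fix x y :: real
    have "x - y \<in> \<int>" if "x - y = of_int (round (x - y))"
      using that by (metis Ints_of_int)
    moreover have "x - y = of_int (round (x - y))" if "x - y \<in> \<int>"
      using that by (elim Ints_cases) simp
    ultimately show "(\<bar>(x - y) - of_int (round (x - y))\<bar> = 0) = (x - y \<in> \<int>)" by auto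
  qed
  show "dist x y \<le> dist x z + dist y z" for x y z :: circle
  proof transfer
    fix x y z :: real
    have "\<bar>(x - y) - of_int (round (x - y))\<bar>
        \<le> \<bar>(x - y) - of_int (round (x - z) - round (y - z))\<bar>"
      by (rule round_diff_minimal)
    then show "\<bar>(x - y) - of_int (round (x - y))\<bar>
        \<le> \<bar>(x - z) - of_int (round (x - z))\<bar> + \<bar>(y - z) - of_int (round (y - z))\<bar>"
      by simp
  qed
qed (rule uniformity_circle_def, rule open_circle_def)

end

lemma compact_circle: "compact (UNIV :: circle set)"
proof -
  have "dist (abs_circle x) (abs_circle y) \<le> dist x y" for x y
    using round_diff_minimal[of "x - y" 0] by (simp add: dist_circle.abs_eq dist_real_def)
  then have "continuous_on {0..1} abs_circle"
    unfolding continuous_on_iff by (meson order_le_less_trans)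
  then have "compact (abs_circle ` {0..1})"
    by (rule compact_continuous_image) simp
  moreover have "abs_circle ` {0..1} = UNIV"
  proof -
    have "z \<in> abs_circle ` {0..1}" for z
    proof (induct z)
      case (1 x)
      have "abs_circle x = abs_circle (frac x)"
        by (simp add: circle.abs_eq_iff frac_def)
      then show ?case
        using frac_ge_0[of x] frac_lt_1[of x] by (intro image_eqI[of _ _ "frac x"]) auto
    qed
    then show ?thesis by auto
  qed
  ultimately show ?thesis by simp
qed

lift_definition rotation :: "real \<Rightarrow> circle \<Rightarrow> circle" is "\<lambda>r x. x + r"
  by simp

end

theory Submission
  imports Defs
begin

text \<open>
  Take the cover of the circle by \<open>16\<close> arcs of length \<open>1 / 8\<close> (\<open>arcs\<close>). Knowing the arcs that
  contain \<open>x\<close> and \<open>x + 2\<^sup>i r\<close> means knowing \<open>2\<^sup>i r\<close> modulo \<open>1\<close> up to an open interval of length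
  \<open>1 / 4\<close>. The binary digits \<open>i + 1\<close> and \<open>i + 2\<close> of \<open>r\<close> say in which quarter of the circle \<open>2\<^sup>i r\<close>
  lies. If digit \<open>i + 2\<close> is known, only two opposite quarters are left; they are \<open>1 / 4\<close> apart, so the
  interval meets just one of them and digit \<open>i + 1\<close> is determined (\<open>next_digit_correct\<close>). From a
  symbolic orbit of length \<open>2\<^sup>K\<close> and the single digit \<open>K + 1\<close> of \<open>r\<close> one can therefore read off the
  digits \<open>K, K - 1, \<dots>, 1\<close>, without knowing \<open>x\<close> and without any trouble from carries
  (\<open>digits_back_eq\<close>).

  This procedure is recursive (\<open>digit_machine\<close>). Apply it to \<open>K = 4 j\<close>: given the number \<open>j\<close> in
  unary, one more digit and a program \<open>p\<close> that produces the symbolic orbit of length \<open>2\<^sup>4\<^sup>j\<close> from that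
  length, it outputs \<open>4 j + 1\<close> digits of \<open>r\<close>. As \<open>r\<close> is random, these have complexity above \<open>3 j\<close> for
  large \<open>j\<close>, whereas the input has length \<open>j + \<bar>p\<bar>\<close> up to a constant. So \<open>\<bar>p\<bar> \<ge> j\<close>
  (\<open>K_hat_rotation_ge\<close>), and at the times \<open>n = 2\<^sup>4\<^sup>j\<close> every symbolic orbit of
  length \<open>n\<close> has conditional complexity at least \<open>log n\<close> times the positive constant \<open>1 / (4 log 2)\<close>.

  The entropy vanishes because a rotation is an isometry: distances do not grow along orbits, so by
  compactness \<open>s(n, \<epsilon>)\<close> is bounded independently of \<open>n\<close>, while \<open>f\<close> tends to infinity
  (\<open>gen_entropy_isometry_eq_0\<close>).
\<close>

section \<open>Recursive functions and their closure properties\<close>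

inductive_cases computes_elims:
  "computes Zero xs z"
  "computes Succ xs z"
  "computes (Proj i) xs z"
  "computes (Comp f gs) xs z"
  "computes (PrimRec f g) (0 # xs) z"
  "computes (PrimRec f g) (Suc n # xs) z"
  "computes (Mu f) xs z"

lemma computes_functional: "computes c xs y \<Longrightarrow> computes c xs z \<Longrightarrow> y = z"
proof (induction arbitrary: z rule: computes.induct)
  case (comp xs gs ys f z')
  from comp.prems obtain ys' where ys': "list_all2 (\<lambda>g y. computes g xs y) gs ys'" "computes f ys' z"
    by (rule computes_elims)
  have "ys = ys'"
    using comp.IH(1) ys'(1) by (auto simp: list_all2_conv_all_nth intro!: nth_equalityI)
  with ys'(2) comp.IH(2) show ?case by blast
next
  case (primrec_Suc f g n xs y z')
  from primrec_Suc.prems obtain y' where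
    "computes (PrimRec f g) (n # xs) y'" "computes g (n # y' # xs) z"
    by (rule computes_elims)
  with primrec_Suc.IH show ?case by blast
next
  case (mu f n xs)
  from mu.prems have z: "computes f (z # xs) 0" "\<forall>m<z. \<exists>y. computes f (m # xs) (Suc y)"
    by (auto elim: computes_elims)
  show ?case
  proof (rule linorder_cases[of n z])
    assume "n < z"
    with z(2) obtain y where "computes f (n # xs) (Suc y)" by blast
    with mu.IH(1) have "0 = Suc y" by blast
    then show ?thesis by simp
  next
    assume "z < n"
    with mu.IH(2) obtain y where "\<And>w. computes f (z # xs) w \<Longrightarrow> Suc y = w" by blast
    with z(1) have "Suc y = 0" by blast
    then show ?thesis by simp
  qed
next
  case (primrec_0 f xs y g)
  from primrec_0.prems have "computes f xs z" by (rule computes_elims)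
  then show ?case by (rule primrec_0.IH)
next
  case (zero xs)
  then show ?case by (auto elim!: computes_elims)
next
  case (succ x)
  then show ?case by (auto elim!: computes_elims)
next
  case (proj i xs)
  then show ?case by (auto elim!: computes_elims)
qed

text \<open>
  Totality is only asked for on lists of length \<open>k\<close>, since codes do not track arities. Closure rules
  are stated for functions of a whole argument list \<open>xs\<close>, so that a goal about a composite expression
  in \<open>xs ! 0, xs ! 1, \<dots>\<close> is solved by applying them as introduction rules.
\<close>

definition recursive :: "nat \<Rightarrow> (nat list \<Rightarrow> nat) \<Rightarrow> bool" where
  "recursive k f \<longleftrightarrow> (\<exists>c. \<forall>xs. length xs = k \<longrightarrow> computes c xs (f xs))"

lemma recursive_cong:
  "recursive k f \<Longrightarrow> (\<And>xs. length xs = k \<Longrightarrow> f xs = g xs) \<Longrightarrow> recursive k g"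
  unfolding recursive_def by force

lemma recursive_proj: "i < k \<Longrightarrow> recursive k (\<lambda>xs. xs ! i)"
  unfolding recursive_def by (rule exI[of _ "Proj i"]) (simp add: computes.proj)

text \<open>
  Inside the step function of a recursion or a minimization, the outer arguments are the tail of a
  longer argument list.
\<close>

lemma recursive_proj_drop: "d + i < k \<Longrightarrow> recursive k (\<lambda>xs. drop d xs ! i)"
  by (rule recursive_cong[OF recursive_proj[of "d + i"]]) auto

lemma recursive_comp:
  assumes "recursive (length gs) f" "\<And>g. g \<in> set gs \<Longrightarrow> recursive k g"
  shows "recursive k (\<lambda>xs. f (map (\<lambda>g. g xs) gs))"
proof -
  obtain cf where cf: "\<And>ys. length ys = length gs \<Longrightarrow> computes cf ys (f ys)"
    using assms(1) unfolding recursive_def by blast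
  obtain cg where cg: "\<And>g xs. g \<in> set gs \<Longrightarrow> length xs = k \<Longrightarrow> computes (cg g) xs (g xs)"
    using assms(2) unfolding recursive_def by metis
  have "computes (Comp cf (map cg gs)) xs (f (map (\<lambda>g. g xs) gs))" if "length xs = k" for xs
    by (rule computes.comp[where ys = "map (\<lambda>g. g xs) gs"])
      (use cf cg that in \<open>auto simp: list_all2_conv_all_nth\<close>)
  then show ?thesis unfolding recursive_def by blast
qed

lemma recursive_comp1:
  assumes "recursive 1 (\<lambda>xs. f (xs ! 0))" "recursive k a"
  shows "recursive k (\<lambda>xs. f (a xs))"
  using recursive_comp[of "[a]" "\<lambda>xs. f (xs ! 0)" k] assms by simp

lemma recursive_Suc:
  assumes "recursive k a"
  shows "recursive k (\<lambda>xs. Suc (a xs))"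
proof (rule recursive_comp1[OF _ assms])
  have "computes Succ xs (Suc (xs ! 0))" if "length xs = 1" for xs
    using that by (cases xs) (auto intro: computes.succ)
  then show "recursive 1 (\<lambda>xs. Suc (xs ! 0))" unfolding recursive_def by blast
qed

lemma recursive_const: "recursive k (\<lambda>xs. n)"
proof (induction n)
  case 0
  show ?case unfolding recursive_def by (rule exI[of _ Zero]) (simp add: computes.zero)
qed (rule recursive_Suc)

lemma recursive_rec_nat:
  assumes b: "recursive k b"
    and s: "recursive (Suc (Suc k)) (\<lambda>xs. s (xs ! 0) (xs ! 1) (drop 2 xs))"
    and n: "recursive k n"
  shows "recursive k (\<lambda>xs. rec_nat (b xs) (\<lambda>i y. s i y xs) (n xs))"
proof -
  obtain cb where cb: "\<And>xs. length xs = k \<Longrightarrow> computes cb xs (b xs)"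
    using b unfolding recursive_def by blast
  obtain cs where cs: "\<And>xs. length xs = Suc (Suc k) \<Longrightarrow> computes cs xs (s (xs ! 0) (xs ! 1) (drop 2 xs))"
    using s unfolding recursive_def by blast
  obtain cn where cn: "\<And>xs. length xs = k \<Longrightarrow> computes cn xs (n xs)"
    using n unfolding recursive_def by blast
  have rec: "computes (PrimRec cb cs) (m # xs) (rec_nat (b xs) (\<lambda>i y. s i y xs) m)"
    if "length xs = k" for m xs
  proof (induction m)
    case (Suc m)
    show ?case
      using computes.primrec_Suc[OF Suc.IH] cs[of "m # _ # xs"] that by simp
  qed (simp add: cb computes.primrec_0 that)
  have "computes (Comp (PrimRec cb cs) (cn # map Proj [0..<k])) xs
      (rec_nat (b xs) (\<lambda>i y. s i y xs) (n xs))" if "length xs = k" for xs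
    by (rule computes.comp[where ys = "n xs # xs"])
      (use that cn rec in \<open>auto simp: list_all2_conv_all_nth nth_Cons intro: computes.proj split: nat.split\<close>)
  then show ?thesis unfolding recursive_def by blast
qed

lemma recursive_Least:
  assumes f: "recursive (Suc k) (\<lambda>xs. f (xs ! 0) (drop 1 xs))"
    and ex: "\<And>xs. length xs = k \<Longrightarrow> \<exists>n. f n xs = 0"
  shows "recursive k (\<lambda>xs. LEAST n. f n xs = 0)"
proof -
  obtain c where c: "\<And>xs. length xs = Suc k \<Longrightarrow> computes c xs (f (xs ! 0) (drop 1 xs))"
    using f unfolding recursive_def by blast
  have "computes (Mu c) xs (LEAST n. f n xs = 0)" if "length xs = k" for xs
  proof (rule computes.mu)
    have c': "computes c (m # xs) (f m xs)" for m
      using c[of "m # xs"] that by simp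
    have "f (LEAST n. f n xs = 0) xs = 0"
      using ex[OF that] by (rule LeastI_ex)
    with c' show "computes c ((LEAST n. f n xs = 0) # xs) 0" by metis
    show "\<forall>m<LEAST n. f n xs = 0. \<exists>y. computes c (m # xs) (Suc y)"
      using c' not_less_Least by (metis not0_implies_Suc)
  qed
  then show ?thesis unfolding recursive_def by blast
qed

lemma recursive_funpow:
  assumes h: "recursive 1 (\<lambda>xs. h (xs ! 0))" and n: "recursive k n" and a: "recursive k a"
  shows "recursive k (\<lambda>xs. (h ^^ n xs) (a xs))"
proof -
  have "recursive k (\<lambda>xs. rec_nat (a xs) (\<lambda>i y. h y) (n xs))"
    by (rule recursive_rec_nat[OF a _ n]) (intro recursive_comp1[OF h] recursive_proj, simp)
  moreover have "rec_nat y (\<lambda>i y. h y) m = (h ^^ m) y" for y m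
    by (induction m) auto
  ultimately show ?thesis by simp
qed

lemma recursive_add:
  assumes "recursive k a" "recursive k b"
  shows "recursive k (\<lambda>xs. a xs + b xs)"
proof -
  have "recursive k (\<lambda>xs. (Suc ^^ a xs) (b xs))"
    by (intro recursive_funpow recursive_Suc recursive_proj assms) simp
  then show ?thesis by (simp add: Suc_funpow)
qed

lemma recursive_diff:
  assumes "recursive k a" "recursive k b"
  shows "recursive k (\<lambda>xs. a xs - b xs)"
proof -
  have "recursive 1 (\<lambda>xs. rec_nat 0 (\<lambda>i y. i) (xs ! 0))"
    by (intro recursive_rec_nat recursive_const recursive_proj) auto
  moreover have "rec_nat 0 (\<lambda>i y. i) n = n - 1" for n :: nat
    by (cases n) auto
  ultimately have "recursive 1 (\<lambda>xs. xs ! 0 - 1)" by simp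
  from recursive_funpow[OF this assms(2,1)]
  have "recursive k (\<lambda>xs. ((\<lambda>n. n - 1) ^^ b xs) (a xs))" .
  moreover have "((\<lambda>n. n - 1) ^^ m) n = n - m" for m n :: nat
    by (induction m) auto
  ultimately show ?thesis by simp
qed

lemma recursive_if_zero:
  assumes "recursive k c" "recursive k a" "recursive k b"
  shows "recursive k (\<lambda>xs. if c xs = 0 then a xs else b xs)"
proof -
  have "recursive 3 (\<lambda>xs. rec_nat (xs ! 1) (\<lambda>i y. xs ! 2) (xs ! 0))"
    by (intro recursive_rec_nat recursive_proj recursive_proj_drop) auto
  moreover have "rec_nat y (\<lambda>i y. z) m = (if m = 0 then y else z)" for y z m :: nat
    by (cases m) auto
  ultimately have "recursive 3 (\<lambda>xs. if xs ! 0 = 0 then xs ! 1 else xs ! 2)" by (simp only:)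
  then have "recursive (length [c, a, b]) (\<lambda>xs. if xs ! 0 = 0 then xs ! 1 else xs ! 2)"
    by (simp add: numeral_3_eq_3)
  moreover have "recursive k g" if "g \<in> set [c, a, b]" for g
    using that assms by auto
  ultimately have "recursive k (\<lambda>xs. if map (\<lambda>g. g xs) [c, a, b] ! 0 = 0
      then map (\<lambda>g. g xs) [c, a, b] ! 1 else map (\<lambda>g. g xs) [c, a, b] ! 2)"
    by (rule recursive_comp)
  then show ?thesis by (simp cong: if_cong)
qed

lemma recursive_mod:
  assumes "recursive k a" and "0 < m"
  shows "recursive k (\<lambda>xs. a xs mod m)"
proof -
  define h where "h y = (if m - Suc y = 0 then 0 else Suc y)" for y
  have "recursive k (\<lambda>xs. (h ^^ a xs) 0)"
    unfolding h_def
    by (intro recursive_funpow recursive_if_zero recursive_diff recursive_const recursive_Suc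
        recursive_proj assms(1)) auto
  moreover have "(h ^^ n) 0 = n mod m" for n
  proof (induction n)
    case (Suc n)
    have "n mod m < m" using \<open>0 < m\<close> by simp
    with Suc show ?case by (auto simp: h_def mod_Suc)
  qed simp
  ultimately show ?thesis by simp
qed

lemma recursive_triangle:
  assumes "recursive k a"
  shows "recursive k (\<lambda>xs. triangle (a xs))"
proof -
  have "recursive k (\<lambda>xs. rec_nat 0 (\<lambda>i y. y + Suc i) (a xs))"
    by (intro recursive_rec_nat recursive_const recursive_add recursive_Suc recursive_proj assms) auto
  moreover have "rec_nat 0 (\<lambda>i y. y + Suc i) n = triangle n" for n
    by (induction n) auto
  ultimately show ?thesis by simp
qed

lemma recursive_prod_encode:
  assumes "recursive k a" "recursive k b"
  shows "recursive k (\<lambda>xs. prod_encode (a xs, b xs))"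
  unfolding prod_encode_def prod.case
  by (intro recursive_add recursive_triangle assms)

text \<open>
  Inverting Cantor's pairing function \<open>(m, n) \<mapsto> triangle (m + n) + m\<close> amounts to finding the
  antidiagonal \<open>m + n\<close>, which is a minimization.
\<close>

definition diagonal :: "nat \<Rightarrow> nat" where
  "diagonal z = (LEAST t. Suc z - triangle (Suc t) = 0)"

lemma diagonal_prod_encode: "diagonal (prod_encode (m, n)) = m + n"
  unfolding diagonal_def
proof (rule Least_equality)
  show "Suc (prod_encode (m, n)) - triangle (Suc (m + n)) = 0"
    by (simp add: prod_encode_def)
next
  fix t
  assume "Suc (prod_encode (m, n)) - triangle (Suc t) = 0"
  then have less: "triangle (m + n) < triangle (Suc t)"
    by (simp add: prod_encode_def)
  have "mono triangle"
    by (rule incseq_SucI) simp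
  with less have "m + n < Suc t"
    by (meson leD leI monoD)
  then show "m + n \<le> t" by simp
qed

lemma prod_decode_conv_diagonal:
  "fst (prod_decode z) = z - triangle (diagonal z)"
  "snd (prod_decode z) = diagonal z - (z - triangle (diagonal z))"
proof -
  obtain m n where z: "z = prod_encode (m, n)"
    by (metis prod_decode_inverse surj_pair)
  show "fst (prod_decode z) = z - triangle (diagonal z)"
    "snd (prod_decode z) = diagonal z - (z - triangle (diagonal z))"
    unfolding z diagonal_prod_encode prod_encode_inverse by (simp_all add: prod_encode_def)
qed

lemma recursive_diagonal:
  assumes "recursive k a"
  shows "recursive k (\<lambda>xs. diagonal (a xs))"
proof (rule recursive_comp1[OF _ assms])
  have "\<exists>t. Suc z - triangle (Suc t) = 0" for z
    by (rule exI[of _ z]) simp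
  then show "recursive 1 (\<lambda>xs. diagonal (xs ! 0))"
    unfolding diagonal_def
    by (intro recursive_Least recursive_diff recursive_triangle recursive_Suc recursive_proj
        recursive_proj_drop) auto
qed

lemma recursive_prod_decode:
  assumes "recursive k a"
  shows "recursive k (\<lambda>xs. fst (prod_decode (a xs)))"
    and "recursive k (\<lambda>xs. snd (prod_decode (a xs)))"
  unfolding prod_decode_conv_diagonal
  by (intro recursive_diff recursive_triangle recursive_diagonal assms)+

section \<open>Recursive operations on encoded strings\<close>

definition enc_hd :: "nat \<Rightarrow> nat" where
  "enc_hd z = fst (prod_decode (z - 1))"

definition enc_tl :: "nat \<Rightarrow> nat" where
  "enc_tl z = snd (prod_decode (z - 1))"

definition enc_nth :: "nat \<Rightarrow> nat \<Rightarrow> nat" where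
  "enc_nth z i = enc_hd ((enc_tl ^^ i) z)"

definition enc_Cons :: "nat \<Rightarrow> nat \<Rightarrow> nat" where
  "enc_Cons x z = Suc (prod_encode (x, z))"

lemma enc_list_encode [simp]:
  "enc_hd (list_encode (x # xs)) = x"
  "enc_tl (list_encode (x # xs)) = list_encode xs"
  "enc_Cons x (list_encode xs) = list_encode (x # xs)"
  by (simp_all add: enc_hd_def enc_tl_def enc_Cons_def)

lemma enc_tl_funpow:
  "i \<le> length xs \<Longrightarrow> (enc_tl ^^ i) (list_encode xs) = list_encode (drop i xs)"
proof (induction i arbitrary: xs)
  case (Suc i)
  then obtain y ys where "xs = y # ys" by (cases xs) auto
  with Suc show ?case by (simp add: funpow_Suc_right del: funpow.simps list_encode.simps)
qed simp

lemma enc_nth_list_encode: "i < length xs \<Longrightarrow> enc_nth (list_encode xs) i = xs ! i"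
  unfolding enc_nth_def
  by (subst enc_tl_funpow, simp, subst Cons_nth_drop_Suc[symmetric]) (simp_all del: list_encode.simps)

lemma recursive_enc_hd:
  "recursive k a \<Longrightarrow> recursive k (\<lambda>xs. enc_hd (a xs))"
  unfolding enc_hd_def by (intro recursive_prod_decode recursive_diff recursive_const)

lemma recursive_enc_tl:
  "recursive k a \<Longrightarrow> recursive k (\<lambda>xs. enc_tl (a xs))"
  unfolding enc_tl_def by (intro recursive_prod_decode recursive_diff recursive_const)

lemma recursive_enc_nth:
  "recursive k a \<Longrightarrow> recursive k b \<Longrightarrow> recursive k (\<lambda>xs. enc_nth (a xs) (b xs))"
  unfolding enc_nth_def
  by (intro recursive_enc_hd recursive_enc_tl recursive_funpow recursive_proj) simp_all

lemma recursive_enc_Cons: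
  "recursive k a \<Longrightarrow> recursive k b \<Longrightarrow> recursive k (\<lambda>xs. enc_Cons (a xs) (b xs))"
  unfolding enc_Cons_def by (intro recursive_Suc recursive_prod_encode)

text \<open>
  A number in unary, closed by a zero, is a self-delimiting prefix of a program. It costs one bit per
  unit, which is cheap enough here and needs only a minimization to be read.
\<close>

definition leading_ones :: "nat \<Rightarrow> nat" where
  "leading_ones z = (LEAST i. enc_nth z i = 0)"

lemma leading_ones_code: "leading_ones (code (replicate j True @ False # p)) = j"
  unfolding leading_ones_def code_def
proof (rule Least_equality)
  let ?q = "map of_bool (replicate j True @ False # p) :: nat list"
  show "enc_nth (list_encode ?q) j = 0"
    by (simp add: enc_nth_list_encode nth_append del: map_append list.map)
  fix i
  assume "enc_nth (list_encode ?q) i = 0"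
  then show "j \<le> i"
    by (rule contrapos_pp) (simp add: enc_nth_list_encode nth_append del: map_append list.map)
qed

lemma recursive_leading_ones:
  assumes "recursive k a"
  shows "recursive k (\<lambda>xs. leading_ones (a xs))"
proof (rule recursive_comp1[OF _ assms])
  have "\<exists>i. enc_nth z i = 0" for z
  proof -
    obtain xs where "z = list_encode xs" by (metis list_decode_inverse)
    then have "enc_nth z (length xs) = 0"
      by (simp add: enc_nth_def enc_tl_funpow) (simp add: enc_hd_def prod_decode_def prod_decode_aux.simps)
    then show ?thesis ..
  qed
  then show "recursive 1 (\<lambda>xs. leading_ones (xs ! 0))"
    unfolding leading_ones_def
    by (intro recursive_Least recursive_enc_nth recursive_proj recursive_proj_drop) auto
qed

lemma recursive_power2:
  assumes "recursive k a"
  shows "recursive k (\<lambda>xs. 2 ^ a xs)"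
proof -
  have "recursive k (\<lambda>xs. ((\<lambda>y. y + y) ^^ a xs) 1)"
    by (intro recursive_funpow recursive_add recursive_const recursive_proj assms) auto
  moreover have "((\<lambda>y. y + y) ^^ n) 1 = (2::nat) ^ n" for n
    by (induction n) auto
  ultimately show ?thesis by simp
qed

lemmas recursive_intros =
  recursive_proj recursive_proj_drop recursive_const recursive_Suc recursive_add recursive_diff
  recursive_mod recursive_power2 recursive_enc_hd recursive_enc_tl
  recursive_enc_nth recursive_enc_Cons recursive_leading_ones recursive_funpow
  recursive_rec_nat

lemma binary_expansion_power2: "binary_expansion (2 ^ k) = True # replicate k False"
proof (induction k)
  case 0
  show ?case by (simp add: binary_expansion.simps)
next
  case (Suc k)
  have "\<not> (2::nat) ^ Suc k < 2" by simp
  then have "binary_expansion (2 ^ Suc k) = binary_expansion (2 ^ k) @ [False]"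
    by (subst binary_expansion.simps) simp
  with Suc show ?case by (simp add: replicate_append_same)
qed

lemma code_power2:
  "code (binary_expansion (2 ^ k)) = enc_Cons 1 ((enc_Cons 0 ^^ k) 0)"
proof -
  have "(enc_Cons 0 ^^ k) 0 = list_encode (replicate k 0)"
    by (induction k) (auto simp: enc_Cons_def)
  then show ?thesis
    by (simp add: code_def binary_expansion_power2 enc_Cons_def)
qed

text \<open>
  Every code is the code of a machine: computations are deterministic, and \<^const>\<open>list_encode\<close> is
  bijective, so each output is the number of exactly one string.
\<close>

lemma machine_of_recf:
  obtains V where "machine V" "\<And>p s. computes c [code p] (list_encode s) \<Longrightarrow> V p = Some s"
proof
  define V where "V p = (if \<exists>s. computes c [code p] (list_encode s)
    then Some (THE s. computes c [code p] (list_encode s)) else None)" for p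
  have uniq: "s = t" if "computes c [code p] (list_encode s)" "computes c [code p] (list_encode t)"
    for p s t
    using computes_functional[OF that] list_encode_eq by blast
  have V: "V p = Some s \<longleftrightarrow> computes c [code p] (list_encode s)" for p s
  proof
    assume "V p = Some s"
    then obtain t where t: "computes c [code p] (list_encode t)" and
      s: "s = (THE s. computes c [code p] (list_encode s))"
      unfolding V_def by (auto split: if_splits)
    have "s = t" unfolding s by (rule the_equality) (use t uniq in auto)
    with t show "computes c [code p] (list_encode s)" by simp
  next
    assume s: "computes c [code p] (list_encode s)"
    then have "(THE s. computes c [code p] (list_encode s)) = s"
      by (rule the_equality) (use s uniq in auto)
    with s show "V p = Some s" unfolding V_def by auto
  qed
  then show "machine V" unfolding machine_def by blast
  show "V p = Some s" if "computes c [code p] (list_encode s)" for p s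
    using V that by blast
qed

section \<open>A machine that reads digits off a symbolic orbit\<close>

text \<open>
  Let \<open>c\<close> be digit \<open>i + 2\<close> of \<open>r\<close>, and let the arcs numbered \<open>u\<close> and \<open>v\<close> contain \<open>x\<close> and \<open>x + 2\<^sup>i r\<close>.
  In units of \<open>1 / 16\<close>, \<open>2\<^sup>i r\<close> differs from \<open>v - u\<close> by less than \<open>2\<close> modulo \<open>16\<close>, and if \<open>b\<close> is digit
  \<open>i + 1\<close>, it lies in \<open>[8 b + 4 c, 8 b + 4 c + 4)\<close>. Hence \<open>v - u - 4 c + 1\<close> is in \<open>8 b + {0, \<dots>, 6}\<close>
  modulo \<open>16\<close>, and \<open>b\<close> is obtained by testing whether the residue is at least \<open>8\<close>. The summand
  \<open>33 = 1 + 2 * 16\<close> keeps the truncated subtraction from cutting off.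
\<close>

definition next_digit :: "nat \<Rightarrow> nat \<Rightarrow> nat \<Rightarrow> nat" where
  "next_digit c u v = 1 - (8 - (v + 33 - (u + 4 * c)) mod 16)"

text \<open>
  Starting from \<open>b\<close> as digit \<open>K + 1\<close>, the digits \<open>K, \<dots>, K + 1 - m\<close> are put in front one by one.
\<close>

primrec digits_back :: "(nat \<Rightarrow> nat) \<Rightarrow> nat \<Rightarrow> nat \<Rightarrow> nat \<Rightarrow> nat list" where
  "digits_back \<omega> K b 0 = [b]"
| "digits_back \<omega> K b (Suc m) =
     (let y = digits_back \<omega> K b m in next_digit (hd y) (\<omega> 0) (\<omega> (2 ^ (K - Suc m))) # y)"

definition enc_digits_back :: "nat \<Rightarrow> nat \<Rightarrow> nat \<Rightarrow> nat \<Rightarrow> nat" where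
  "enc_digits_back S K b m = rec_nat (enc_Cons b 0)
     (\<lambda>i y. enc_Cons (next_digit (enc_hd y) (enc_nth S 0) (enc_nth S (2 ^ (K - Suc i)))) y) m"

lemma enc_digits_back:
  "m \<le> K \<Longrightarrow> enc_digits_back (list_encode (map \<omega> [0..<2 ^ K])) K b m =
     list_encode (digits_back \<omega> K b m)"
proof (induction m)
  case 0
  show ?case by (simp add: enc_digits_back_def enc_Cons_def)
next
  case (Suc m)
  obtain y ys where y: "digits_back \<omega> K b m = y # ys"
    by (cases m) (auto simp: Let_def)
  have "K - Suc m < K" using Suc.prems by simp
  then have "(2::nat) ^ (K - Suc m) < 2 ^ K" by simp
  then have "enc_nth (list_encode (map \<omega> [0..<2 ^ K])) (2 ^ (K - Suc m)) = \<omega> (2 ^ (K - Suc m))"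
    "enc_nth (list_encode (map \<omega> [0..<2 ^ K])) 0 = \<omega> 0"
    by (simp_all add: enc_nth_list_encode)
  moreover have "enc_digits_back (list_encode (map \<omega> [0..<2 ^ K])) K b m = list_encode (y # ys)"
    using Suc y by simp
  ultimately show ?case
    by (simp add: enc_digits_back_def y Let_def del: list_encode.simps)
qed

lemma recursive_enc_digits_back:
  assumes "recursive k S" "recursive k K" "recursive k b" "recursive k m"
  shows "recursive k (\<lambda>xs. enc_digits_back (S xs) (K xs) (b xs) (m xs))"
proof -
  have four: "4 * c = c + c + c + c" for c :: nat by simp
  have "recursive 4 (\<lambda>xs. enc_digits_back (xs ! 0) (xs ! 1) (xs ! 2) (xs ! 3))"
    unfolding enc_digits_back_def next_digit_def four
    by (intro recursive_intros) simp_all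
  then have "recursive (length [S, K, b, m]) (\<lambda>xs. enc_digits_back (xs ! 0) (xs ! 1) (xs ! 2) (xs ! 3))"
    by (simp add: eval_nat_numeral)
  from recursive_comp[OF this, of k] assms show ?thesis by auto
qed

text \<open>
  The machine runs \<open>U\<close> on the pair of the length \<open>2\<^sup>4\<^sup>j\<close> and \<open>p\<close>, and reads the digits off the
  resulting symbolic orbit. Both \<open>j\<close>, needed before and after this run, and the first digit \<open>b\<close> are
  read from the prefix of the input.
\<close>

lemma digit_machine:
  assumes "recursive_pairing pr" "machine U"
  obtains V where "machine V"
    "\<And>j b p \<omega>. U (pr (binary_expansion (2 ^ (4 * j))) p) = Some (map \<omega> [0..<2 ^ (4 * j)]) \<Longrightarrow>
       V (replicate j True @ False # b # p) = Some (digits_back \<omega> (4 * j) (of_bool b) (4 * j))"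
proof -
  obtain cp where cp: "\<And>s p. computes cp [code s, code p] (code (pr s p))"
    using assms(1) unfolding recursive_pairing_def by blast
  obtain cU where cU: "\<And>p s. U p = Some s \<longleftrightarrow> computes cU [code p] (list_encode s)"
    using assms(2) unfolding machine_def by blast
  define K where "K z = leading_ones z + leading_ones z + leading_ones z + leading_ones z" for z
  have "recursive 1 (\<lambda>xs. enc_Cons 1 ((enc_Cons 0 ^^ K (xs ! 0)) 0))"
    unfolding K_def by (intro recursive_intros) simp_all
  then obtain cA where
    cA: "\<And>xs. length xs = 1 \<Longrightarrow> computes cA xs (enc_Cons 1 ((enc_Cons 0 ^^ K (xs ! 0)) 0))"
    unfolding recursive_def by blast
  have "recursive 1 (\<lambda>xs. (enc_tl ^^ (leading_ones (xs ! 0) + 2)) (xs ! 0))"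
    by (intro recursive_intros) simp_all
  then obtain cB where
    cB: "\<And>xs. length xs = 1 \<Longrightarrow> computes cB xs ((enc_tl ^^ (leading_ones (xs ! 0) + 2)) (xs ! 0))"
    unfolding recursive_def by blast
  have "recursive 2 (\<lambda>xs. enc_digits_back (xs ! 0) (K (xs ! 1))
      (enc_nth (xs ! 1) (Suc (leading_ones (xs ! 1)))) (K (xs ! 1)))"
    unfolding K_def by (intro recursive_enc_digits_back recursive_intros) simp_all
  then obtain cG where
    cG: "\<And>xs. length xs = 2 \<Longrightarrow> computes cG xs (enc_digits_back (xs ! 0) (K (xs ! 1))
      (enc_nth (xs ! 1) (Suc (leading_ones (xs ! 1)))) (K (xs ! 1)))"
    unfolding recursive_def by blast
  define c where "c = Comp cG [Comp cU [Comp cp [cA, cB]], Proj 0]"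
  obtain V where V: "machine V" "\<And>p s. computes c [code p] (list_encode s) \<Longrightarrow> V p = Some s"
    using machine_of_recf[of c] by metis
  show thesis
  proof (rule that[OF V(1)], rule V(2))
    fix j b p and \<omega> :: "nat \<Rightarrow> nat"
    let ?n = "(2::nat) ^ (4 * j)" and ?q = "replicate j True @ False # b # p"
    let ?s = "map \<omega> [0..<?n]"
    assume U: "U (pr (binary_expansion ?n) p) = Some ?s"
    have j: "leading_ones (code ?q) = j"
      by (rule leading_ones_code)
    then have K: "K (code ?q) = 4 * j"
      by (simp add: K_def)
    have q: "code ?q = list_encode (replicate j 1 @ 0 # of_bool b # map of_bool p)"
      by (simp add: code_def del: list_encode.simps)
    have "computes cA [code ?q] (code (binary_expansion ?n))"
      using cA[of "[code ?q]"] by (simp add: K code_power2)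
    moreover have "computes cB [code ?q] (code p)"
    proof -
      have "(enc_tl ^^ (j + 2)) (code ?q) = code p"
        unfolding q by (subst enc_tl_funpow) (simp_all add: code_def)
      with cB[of "[code ?q]"] show ?thesis by (simp add: j)
    qed
    ultimately have "computes (Comp cp [cA, cB]) [code ?q] (code (pr (binary_expansion ?n) p))"
      by (intro computes.comp[where ys = "[code (binary_expansion ?n), code p]"]) (simp_all add: cp)
    then have "computes (Comp cU [Comp cp [cA, cB]]) [code ?q] (list_encode ?s)"
      using U by (intro computes.comp[where ys = "[code (pr (binary_expansion ?n) p)]"]) (simp_all add: cU)
    moreover have "computes (Proj 0) [code ?q] (code ?q)"
      using computes.proj[of 0 "[code ?q]"] by simp
    moreover have "computes cG [list_encode ?s, code ?q]
        (list_encode (digits_back \<omega> (4 * j) (of_bool b) (4 * j)))"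
    proof -
      have "enc_nth (code ?q) (Suc j) = of_bool b"
        unfolding q by (subst enc_nth_list_encode) (simp_all add: nth_append)
      with cG[of "[list_encode ?s, code ?q]"] enc_digits_back[of "4 * j" "4 * j" \<omega> "of_bool b"]
      show ?thesis by (simp add: j K)
    qed
    ultimately show "computes c [code ?q] (list_encode (digits_back \<omega> (4 * j) (of_bool b) (4 * j)))"
      unfolding c_def by (intro computes.comp[where ys = "[list_encode ?s, code ?q]"]) simp_all
  qed
qed

section \<open>Arcs, rotations and binary digits\<close>

text \<open>
  The centres are as far apart as the radius: consecutive arcs overlap, so the circle is covered, and
  no arc contains the centre of another one, so the arcs are distinct.
\<close>

definition arcs :: "circle set list" where
  "arcs = map (\<lambda>u. ball (abs_circle (real u / 16)) (1 / 16)) [0..<16]"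

lemma dist_circle_less_iff:
  assumes "e \<le> 1 / 2"
  shows "dist (abs_circle x) (abs_circle y) < e \<longleftrightarrow> (\<exists>m::int. \<bar>x - y - of_int m\<bar> < e)"
  unfolding dist_circle.abs_eq using round_diff_minimal[of "x - y"] by (meson order_le_less_trans)

lemma length_arcs: "length arcs = 16"
  by (simp add: arcs_def)

lemma arcs_nth: "u < 16 \<Longrightarrow> arcs ! u = ball (abs_circle (real u / 16)) (1 / 16)"
  by (simp add: arcs_def)

lemma mem_arcs_iff:
  assumes "u < 16"
  shows "abs_circle t \<in> arcs ! u \<longleftrightarrow> (\<exists>m::int. \<bar>real u / 16 - t - of_int m\<bar> < 1 / 16)"
  unfolding arcs_nth[OF assms] mem_ball by (rule dist_circle_less_iff) simp

lemma finite_open_cover_arcs: "finite_open_cover arcs"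
  unfolding finite_open_cover_def
proof (intro conjI)
  have "u = v" if uv: "u < 16" "v < 16" and eq: "arcs ! u = arcs ! v" for u v
  proof -
    have "abs_circle (real u / 16) \<in> arcs ! u"
      using uv(1) by (simp add: arcs_nth)
    then have "abs_circle (real u / 16) \<in> arcs ! v"
      unfolding eq .
    then obtain m :: int where "\<bar>real v / 16 - real u / 16 - of_int m\<bar> < 1 / 16"
      using uv mem_arcs_iff by blast
    then have "\<bar>int v - int u - 16 * m\<bar> < 1" by linarith
    with uv show ?thesis by presburger
  qed
  then show "distinct arcs"
    by (auto simp: distinct_conv_nth length_arcs)
  show "\<forall>B\<in>set arcs. open B"
    by (auto simp: arcs_def)
  have "\<exists>u<16. abs_circle t \<in> arcs ! u" for t
  proof -
    define i where "i = \<lfloor>16 * t\<rfloor>"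
    define u where "u = nat (i mod 16)"
    have u: "i = int u + 16 * (i div 16)" "u < 16"
      unfolding u_def by auto
    have "real_of_int i = real u + 16 * real_of_int (i div 16)"
      by (subst u(1)) simp
    moreover have "real_of_int i \<le> 16 * t" "16 * t < real_of_int i + 1"
      unfolding i_def by linarith+
    ultimately have "\<bar>real u / 16 - t - of_int (- (i div 16))\<bar> < 1 / 16"
      by simp
    with u(2) show ?thesis using mem_arcs_iff by blast
  qed
  then have "\<exists>u<16. x \<in> arcs ! u" for x
    by (induct x) auto
  then show "\<Union> (set arcs) = UNIV"
    unfolding set_conv_nth length_arcs by blast
qed

lemma rotation_funpow: "(rotation r ^^ n) (abs_circle t) = abs_circle (t + real n * r)"
  by (induction n) (simp_all add: rotation.abs_eq algebra_simps)

lemma next_digit_correct: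
  assumes u: "u < 16" "abs_circle t \<in> arcs ! u"
    and v: "v < 16" "abs_circle (t + 2 ^ i * r) \<in> arcs ! v"
  shows "next_digit (binary_digit r (i + 2)) u v = binary_digit r (i + 1)"
proof -
  obtain k :: int where k: "\<bar>real u / 16 - t - of_int k\<bar> < 1 / 16"
    using u mem_arcs_iff by blast
  obtain l :: int where l: "\<bar>real v / 16 - (t + 2 ^ i * r) - of_int l\<bar> < 1 / 16"
    using v mem_arcs_iff by blast
  define y where "y = 2 ^ i * r"
  define b where "b = \<lfloor>2 * y\<rfloor> mod 2"
  define c where "c = \<lfloor>4 * y\<rfloor> mod 2"
  have digits: "binary_digit r (i + 1) = nat b" "binary_digit r (i + 2) = nat c"
    by (simp_all add: binary_digit_def b_def c_def y_def mult.assoc)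
  have bc: "0 \<le> b" "b < 2" "0 \<le> c" "c < 2" by (simp_all add: b_def c_def)
  have floor: "\<lfloor>4 * y\<rfloor> = 4 * \<lfloor>y\<rfloor> + 2 * b + c"
  proof -
    have "\<lfloor>4 * y\<rfloor> div 2 = \<lfloor>2 * y\<rfloor>" "\<lfloor>2 * y\<rfloor> div 2 = \<lfloor>y\<rfloor>" by linarith+
    then show ?thesis unfolding b_def c_def by presburger
  qed
  define M where "M = k - l - \<lfloor>y\<rfloor>"
  have "\<bar>real v - real u - 16 * y + 16 * of_int (k - l)\<bar> < 2"
  proof -
    have "real u / 16 - t - of_int k < 1 / 16" "- (real u / 16 - t - of_int k) < 1 / 16"
      "real v / 16 - (t + y) - of_int l < 1 / 16" "- (real v / 16 - (t + y) - of_int l) < 1 / 16"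
      using k l unfolding y_def[symmetric] abs_less_iff by blast+
    then show ?thesis
      unfolding of_int_diff abs_less_iff by (intro conjI; argo)
  qed
  moreover have "real_of_int (4 * \<lfloor>y\<rfloor> + 2 * b + c) \<le> 4 * y"
    "4 * y < real_of_int (4 * \<lfloor>y\<rfloor> + 2 * b + c) + 1"
    unfolding floor[symmetric] by linarith+
  ultimately have "-2 < int v - int u + 16 * M - 8 * b - 4 * c"
    "int v - int u + 16 * M - 8 * b - 4 * c < 6"
    unfolding M_def by simp_all
  moreover define s where "s = int v - int u + 16 * M - 8 * b - 4 * c + 1"
  moreover define e where "e = v + 33 - (u + 4 * nat c)"
  ultimately have s: "0 \<le> s" "s < 7" "int e = (8 * b + s) + 16 * (2 - M)"
    using bc u(1) by simp_all
  then have "int (e mod 16) = (8 * b + s) mod 16"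
    unfolding zmod_int s(3) by (simp only: of_nat_numeral mod_mult_self2)
  also have "\<dots> = 8 * b + s"
    using s bc by (intro mod_pos_pos_trivial) auto
  finally have "1 - (8 - e mod 16) = nat b"
    using s bc by linarith
  then show ?thesis
    unfolding next_digit_def digits e_def .
qed

lemma digits_back_eq:
  assumes \<omega>: "\<omega> \<in> symbolic_orbits (rotation r) arcs x" and "m \<le> K"
  shows "digits_back \<omega> K (binary_digit r (K + 1)) m = map (binary_digit r) [K + 1 - m..<K + 2]"
  using \<open>m \<le> K\<close>
proof (induction m)
  case (Suc m)
  define i where "i = K - Suc m"
  have i: "K + 1 - m = i + 2" "K + 1 - Suc m = i + 1" "i + 2 < K + 2"
    using Suc.prems by (auto simp: i_def)
  obtain t where x: "x = abs_circle t" by (induct x) auto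
  have orbit: "\<omega> n < 16 \<and> abs_circle (t + real n * r) \<in> arcs ! \<omega> n" for n
    using \<omega> by (auto simp: symbolic_orbits_def x rotation_funpow length_arcs)
  have "next_digit (binary_digit r (i + 2)) (\<omega> 0) (\<omega> (2 ^ i)) = binary_digit r (i + 1)"
    using orbit[of 0] orbit[of "2 ^ i"] by (intro next_digit_correct) auto
  moreover have "digits_back \<omega> K (binary_digit r (K + 1)) m = map (binary_digit r) [i + 2..<K + 2]"
    unfolding i(1)[symmetric] using Suc.prems by (intro Suc.IH) simp
  moreover have "[i + 1..<K + 2] = (i + 1) # [i + 2..<K + 2]"
    "[i + 2..<K + 2] = (i + 2) # [Suc (i + 2)..<K + 2]"
    using i(3) by (simp_all add: upt_conv_Cons del: upt_Suc)
  ultimately show ?case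
    unfolding digits_back.simps Let_def i(2) i_def[symmetric] by (simp del: upt_Suc)
qed simp

section \<open>Orbit complexity\<close>

lemma AIC_le: "U p = Some s \<Longrightarrow> AIC U s \<le> enat (length p)"
  unfolding AIC_def by (rule INF_lower) simp

text \<open>
  Times of the form \<open>2\<^sup>4\<^sup>j\<close> are used because they can be specified by only \<open>j\<close> bits, a fixed fraction
  of the number of digits of \<open>r\<close> that the orbit reveals. An arbitrary time \<open>n\<close> would cost about
  \<open>log n\<close> bits, as much as is gained.
\<close>

lemma K_hat_rotation_ge:
  assumes "recursive_pairing pr" "universal_machine U pr" "random_real U r"
  shows "eventually (\<lambda>j. enat j \<le> K_hat U pr x (rotation r) arcs (2 ^ (4 * j))) sequentially"
proof -
  have machine: "machine U" and universal: "\<And>V. machine V \<Longrightarrow> \<exists>w. \<forall>p. U (w @ p) = V p"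
    using assms(2) unfolding universal_machine_def by auto
  obtain V where V: "machine V"
    "\<And>j b p \<omega>. U (pr (binary_expansion (2 ^ (4 * j))) p) = Some (map \<omega> [0..<2 ^ (4 * j)]) \<Longrightarrow>
       V (replicate j True @ False # b # p) = Some (digits_back \<omega> (4 * j) (of_bool b) (4 * j))"
    using digit_machine[OF assms(1) machine] by blast
  obtain w where w: "\<And>p. U (w @ p) = V p"
    using universal[OF V(1)] by blast
  define A where "A n = AIC U (map (binary_digit r) [1..<n+1])" for n
  have "(\<lambda>n. ereal_of_enat (A n) / ereal (real n)) \<longlonglongrightarrow> 1"
    using assms(3) unfolding random_real_def A_def by blast
  then have "eventually (\<lambda>n. ereal (3 / 4) < ereal_of_enat (A n) / ereal (real n)) sequentially"
    by (rule order_tendstoD) simp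
  moreover have "filterlim (\<lambda>j::nat. 4 * j + 1) sequentially sequentially"
    by (rule filterlim_subseq) (auto simp: strict_mono_def)
  ultimately have "eventually (\<lambda>j. ereal (3 / 4) <
      ereal_of_enat (A (4 * j + 1)) / ereal (real (4 * j + 1))) sequentially"
    by (rule eventually_compose_filterlim)
  \<comment> \<open>This \<open>j\<close> absorbs the constant cost of the emulation prefix \<open>w\<close>, the delimiter and one digit.\<close>
  moreover have "eventually (\<lambda>j. length w + 2 \<le> j) sequentially"
    by (rule eventually_ge_at_top)
  ultimately show ?thesis
  proof eventually_elim
    case (elim j)
    have "j \<le> length p"
      if \<omega>: "\<omega> \<in> symbolic_orbits (rotation r) arcs x"
      and p: "U (pr (binary_expansion (2 ^ (4 * j))) p) = Some (map \<omega> [0..<2 ^ (4 * j)])"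
      for \<omega> p
    proof -
      define b where "b = (binary_digit r (4 * j + 1) = 1)"
      have b: "of_bool b = binary_digit r (4 * j + 1)"
        unfolding b_def binary_digit_def by (auto simp: nat_eq_iff)
      have "U (w @ replicate j True @ False # b # p) =
          Some (map (binary_digit r) [1..<4 * j + 1 + 1])"
        using V(2)[OF p, of b] digits_back_eq[OF \<omega>, of "4 * j" "4 * j"] unfolding w b by simp
      from AIC_le[of U, OF this] have "A (4 * j + 1) \<le> enat (length w + j + 2 + length p)"
        unfolding A_def by (simp add: add_ac)
      then obtain a where a: "A (4 * j + 1) = enat a" "a \<le> length w + j + 2 + length p"
        by (metis enat_ile enat_ord_simps(1))
      have "3 / 4 < real a / real (4 * j + 1)"
        using elim(1) unfolding a by simp
      \<comment> \<open>\<open>3 j < a \<le> \<bar>w\<bar> + j + 2 + \<bar>p\<bar> \<le> 2 j + \<bar>p\<bar>\<close>\<close>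
      then have "3 * j < a" by (simp add: field_simps)
      with a(2) elim(2) show ?thesis by linarith
    qed
    then show ?case
      unfolding K_hat_def AIC_cond_def by (auto intro!: INF_greatest)
  qed
qed

lemma orbit_complexity_rotation_pos:
  assumes "recursive_pairing pr" "universal_machine U pr" "random_real U r"
  shows "0 < orbit_complexity U pr (\<lambda>n. ln (real n)) x (rotation r)"
proof -
  define X where "X n = ereal_of_enat (K_hat U pr x (rotation r) arcs n) / ereal (ln (real n))" for n
  have "eventually (\<lambda>j. ereal (1 / (4 * ln 2)) \<le> (X \<circ> (\<lambda>j. 2 ^ (4 * j))) j) sequentially"
    using K_hat_rotation_ge[OF assms, of x] eventually_gt_at_top[of 0]
  proof eventually_elim
    case (elim j)
    have ln: "ln (real (2 ^ (4 * j))) = 4 * real j * ln 2"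
      by (simp add: ln_realpow)
    have "ereal (1 / (4 * ln 2)) = ereal_of_enat (enat j) / ereal (ln (real (2 ^ (4 * j))))"
      unfolding ln using elim(2) by simp
    also have "\<dots> \<le> X (2 ^ (4 * j))"
      unfolding X_def
      by (rule ereal_divide_right_mono) (use elim in \<open>simp_all only: ereal_of_enat_le_iff ln, simp\<close>)
    finally show ?case by simp
  qed
  then have "ereal (1 / (4 * ln 2)) \<le> limsup (X \<circ> (\<lambda>j. 2 ^ (4 * j)))"
    by (rule le_Limsup[rotated]) simp
  also have "\<dots> \<le> limsup X"
    by (rule limsup_subseq_mono) (simp add: strict_mono_def)
  also have "\<dots> = K_hat_cover U pr (\<lambda>n. ln (real n)) x (rotation r) arcs"
    by (simp add: K_hat_cover_def X_def[abs_def])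
  also have "\<dots> \<le> orbit_complexity U pr (\<lambda>n. ln (real n)) x (rotation r)"
    unfolding orbit_complexity_def by (rule SUP_upper) (simp add: finite_open_cover_arcs)
  finally have "ereal (1 / (4 * ln 2)) \<le> orbit_complexity U pr (\<lambda>n. ln (real n)) x (rotation r)" .
  moreover have "0 < ereal (1 / (4 * ln 2))" by simp
  ultimately show ?thesis by (rule less_le_trans[rotated])
qed

section \<open>Entropy of isometries\<close>

lemma isometry_funpow:
  fixes T :: "'a::metric_space \<Rightarrow> 'a"
  assumes "\<And>x y. dist (T x) (T y) = dist x y"
  shows "dist ((T ^^ n) x) ((T ^^ n) y) = dist x y"
  by (induction n) (simp_all add: assms)

text \<open>
  Points that an isometry separates at any time have distance above \<open>\<epsilon>\<close> from the start, so they never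
  share a ball of radius \<open>\<epsilon> / 2\<close>, and finitely many such balls cover the space.
\<close>

lemma max_separated_isometry_bounded:
  fixes T :: "'a::metric_space \<Rightarrow> 'a"
  assumes "compact (UNIV :: 'a set)" and isometry: "\<And>x y. dist (T x) (T y) = dist x y" and "0 < \<epsilon>"
  obtains M where "\<And>n. max_separated T n \<epsilon> \<le> enat M"
proof -
  obtain C where C: "finite C" "UNIV = (\<Union>c\<in>C. ball c (\<epsilon> / 2) :: 'a set)"
    using seq_compact_imp_totally_bounded[OF compact_imp_seq_compact[OF assms(1)], rule_format, of "\<epsilon> / 2"] \<open>0 < \<epsilon>\<close>
    by auto
  then obtain near where near: "\<And>x. near x \<in> C" "\<And>x. dist (near x) x < \<epsilon> / 2"
    by (metis UN_E UNIV_I mem_ball)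
  have "card E \<le> card C" if "separated_set T n \<epsilon> E" for E n
  proof (rule card_inj_on_le)
    show "inj_on near E"
    proof
      fix x y
      assume xy: "x \<in> E" "y \<in> E" and eq: "near x = near y"
      have "dist x y < \<epsilon>"
        using near(2)[of x] near(2)[of y] eq by (metis dist_commute dist_triangle_half_l)
      then have "\<not> separated_points T n \<epsilon> x y"
        by (simp add: separated_points_def isometry_funpow[OF isometry])
      with that xy show "x = y" unfolding separated_set_def by blast
    qed
  qed (use near C in auto)
  then have "max_separated T n \<epsilon> \<le> enat (card C)" for n
    unfolding max_separated_def by (intro SUP_least) auto
  then show thesis by (rule that)
qed

lemma gen_entropy_isometry_eq_0:
  fixes T :: "'a::metric_space \<Rightarrow> 'a"
  assumes "compact (UNIV :: 'a set)" "\<And>x y. dist (T x) (T y) = dist x y"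
    and f: "filterlim f at_top sequentially"
  shows "gen_entropy f T = 0"
proof -
  have "entropy_at f T \<epsilon> = 0" if pos: "0 < \<epsilon>" for \<epsilon>
  proof -
    obtain M where M: "\<And>n. max_separated T n \<epsilon> \<le> enat M"
      using max_separated_isometry_bounded[OF assms(1,2) pos] by metis
    define s where "s n = the_enat (max_separated T n \<epsilon>)" for n
    have s: "max_separated T n \<epsilon> = enat (s n)" "s n \<le> M" for n
      using M[of n] unfolding s_def by (cases "max_separated T n \<epsilon>"; simp)+
    have ln: "0 \<le> ln (real (s n))" "ln (real (s n)) \<le> ln (real (Suc M))" for n
      using s(2)[of n] by (cases "s n = 0"; simp)+
    have "(\<lambda>n. ln (real (Suc M)) / f n) \<longlonglongrightarrow> 0"
      by (rule tendsto_divide_0[OF tendsto_const filterlim_at_top_imp_at_infinity[OF f]])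
    then have "(\<lambda>n. ln (real (s n)) / f n) \<longlonglongrightarrow> 0"
    proof (rule tendsto_sandwich[OF _ _ tendsto_const, rotated 2])
      have pos: "eventually (\<lambda>n. 0 < f n) sequentially"
        using f by (simp add: filterlim_at_top_dense)
      then show "eventually (\<lambda>n. 0 \<le> ln (real (s n)) / f n) sequentially"
        by eventually_elim (simp add: ln)
      from pos show "eventually (\<lambda>n. ln (real (s n)) / f n \<le> ln (real (Suc M)) / f n) sequentially"
        by eventually_elim (intro divide_right_mono ln, simp)
    qed
    then have "(\<lambda>n. ereal (ln (real (s n)) / f n)) \<longlonglongrightarrow> 0"
      by (simp add: zero_ereal_def)
    moreover have "eventually (\<lambda>n. log_enat (max_separated T n \<epsilon>) / ereal (f n) =
        ereal (ln (real (s n)) / f n)) sequentially"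
      using filterlim_at_top_dense[THEN iffD1, OF f, rule_format, of 0]
      by eventually_elim (simp add: s)
    ultimately have "(\<lambda>n. log_enat (max_separated T n \<epsilon>) / ereal (f n)) \<longlonglongrightarrow> 0"
      by (simp add: tendsto_cong)
    then show ?thesis
      unfolding entropy_at_def by (intro lim_imp_Limsup) simp_all
  qed
  then have "eventually (\<lambda>\<epsilon>. entropy_at f T \<epsilon> = 0) (at_right 0)"
    by (simp add: eventually_at_right_less eventually_mono[OF eventually_at_right_less])
  then show ?thesis
    unfolding gen_entropy_def by (intro tendsto_Lim tendsto_eventually) simp_all
qed

lemma dist_rotation: "dist (rotation r x) (rotation r y) = dist x y"
  by transfer simp

theorem proposition37:
  fixes U :: "bool list \<Rightarrow> nat list option"
    and pr :: "bool list \<Rightarrow> bool list \<Rightarrow> bool list"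
    and r :: real
  assumes "recursive_pairing pr" and "universal_machine U pr"
    and "random_real U r"
  shows "(\<forall>x. orbit_complexity U pr (\<lambda>n. ln (real n)) x (rotation r) > 0) \<and>
    (\<forall>f :: nat \<Rightarrow> real. mono f \<longrightarrow> filterlim f at_top sequentially \<longrightarrow>
       gen_entropy f (rotation r) = 0)"
  using orbit_complexity_rotation_pos[OF assms]
    gen_entropy_isometry_eq_0[OF compact_circle dist_rotation] by blast

end
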